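(* Let $A$ and $B$ be time series, let $d_{A,B}$ be a dissimilarity function with nonnegative integer values, let $c=\max_{i,j}d_{A,B}(i,j)$, and let $R_{A,B}$ be the weighted integer sequence defined in the context. For any indices $1\le i_\vdash\le i_\dashv\le|A|$ and $1\le j_\vdash\le j_\dashv\le |B|$, the DTW distance between $A[i_\vdash:i_\dashv]$ and $B[j_\vdash:j_\dashv]$ equals $c\,(|A[i_\vdash:i_\dashv]|+|B[j_\vdash:j_\dashv]|+1)$ minus the $[r(i_\vdash,j_\vdash):r(i_\dashv,j_\dashv)]$-banded HIS weight of $R_{A,B}[f(i_\vdash,j_\vdash):f(i_\dashv,j_\dashv)]$.
   Context: Sequences are 1-indexed; for a sequence $S$, $|S|$ is its length, $S[i]$ its $i$-th element, $S[a:b]=S[a]\circ\cdots\circ S[b]$, $\circ$ is concatenation. A subsequence of $S$ is $S[i_1]\circ\cdots\circ S[i_\ell]$ with $\ell\ge1$ and $i_1<\cdots<i_\ell$. A time series is a nonempty finite sequence; for time series $A,B$, $d_{A,B}(i,j)$ ($1\le i\le|A|$, $1\le j\le|B|$) is a nonnegative integer (dissimilarity of $A[i]$ and $B[j]$). An alignment of $A[i_\vdash:i_\dashv]$ and $B[j_\vdash:j_\dashv]$ is a sequence $P=(i_1,j_1)\circ\cdots\circ(i_{|P|},j_{|P|})$ with $(i_1,j_1)=(i_\vdash,j_\vdash)$, $(i_{|P|},j_{|P|})=(i_\dashv,j_\dashv)$, and for $2\le k\le|P|$, $(i_k,j_k)\in\{(i_{k-1}+1,j_{k-1}+1),(i_{k-1}+1,j_{k-1}),(i_{k-1},j_{k-1}+1)\}$.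 Its discrepancy is $d_{A,B}(P)=\sum_{k=1}^{|P|}d_{A,B}(i_k,j_k)$. The DTW distance between $A[i_\vdash:i_\dashv]$ and $B[j_\vdash:j_\dashv]$ is the minimum discrepancy over all their alignments. For a sequence $S$ of integers, each element $s$ having a nonnegative weight $w(s)$: a subsequence is increasing if each element other than the last is less than the next one; it is $[h_\vdash:h_\dashv]$-banded if all its elements lie in $[h_\vdash,h_\dashv]$. The $[h_\vdash:h_\dashv]$-banded HIS (heaviest increasing subsequence) weight of $S$ is the maximum of $\sum_{s\in T}w(s)$ over all $[h_\vdash:h_\dashv]$-banded increasing subsequences $T$ of $S$. The sequence $R_{A,B}$ has length $|A||B|+(|A|-1)(|B|-1)$ and consists of distinct weighted integers. For $1\le i\le|A|$, $1\le j\le|B|$: $r(i,j)=(j-1)(2|A|-1)+i$, occurring at position $f(i,j)=f(r(i,j))=(i-1)(2|B|-1)+j$ of $R_{A,B}$, with weight $c-d_{A,B}(i,j)$. For $2\le i\le|A|$, $2\le j\le|B|$: $\tilde r(i,j)=(j-1)(2|A|-1)-i+2$, occurring at position $(i-1)(2|B|-1)-j+2$, with weight $c$. These positions are exactly $1,\dots,|R_{A,B}|$.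
   Formalization: The constant +1 is corrected to −1: the DTW distance equals c(|A[i⊢:i⊣]|+|B[j⊢:j⊣]|−1) minus the banded HIS weight; with +1 the claim fails whenever c>0 (e.g. |A|=|B|=1, d=1 gives 3 instead of 1). *)

theory Defs
  imports Main "HOL-Library.Sublist"
begin

(* Sequences are lists. List access is 0-based, the mathematics is 1-based, so the p-th element
   of S is S ! (p - 1). *)

definition slice :: "'a list \<Rightarrow> nat \<Rightarrow> nat \<Rightarrow> 'a list" where
  "slice S a b = map (\<lambda>p. S ! (p - 1)) [a..<b + 1]"

definition alignment :: "nat \<Rightarrow> nat \<Rightarrow> nat \<Rightarrow> nat \<Rightarrow> (nat \<times> nat) list \<Rightarrow> bool" where
  "alignment i1 i2 j1 j2 P \<longleftrightarrow>
     P \<noteq> [] \<and> hd P = (i1, j1) \<and> last P = (i2, j2) \<and>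
     successively (\<lambda>(i, j) q. q \<in> {(i + 1, j + 1), (i + 1, j), (i, j + 1)}) P"

definition discrepancy :: "(nat \<Rightarrow> nat \<Rightarrow> nat) \<Rightarrow> (nat \<times> nat) list \<Rightarrow> nat" where
  "discrepancy d P = (\<Sum>(i, j)\<leftarrow>P. d i j)"

(* The DTW distance between A[i1:i2] and B[j1:j2]. The time series enter only through the
   dissimilarities d i j of A[i] and B[j]. *)
definition dtw :: "(nat \<Rightarrow> nat \<Rightarrow> nat) \<Rightarrow> nat \<Rightarrow> nat \<Rightarrow> nat \<Rightarrow> nat \<Rightarrow> nat" where
  "dtw d i1 i2 j1 j2 = Min {discrepancy d P | P. alignment i1 i2 j1 j2 P}"

(* A weighted integer sequence is a list of pairs (element, weight). *)
definition banded_HIS_weight :: "int \<Rightarrow> int \<Rightarrow> (int \<times> int) list \<Rightarrow> int" where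
  "banded_HIS_weight h1 h2 S =
     Max {sum_list (map snd T) | T. T \<noteq> [] \<and> subseq T S \<and>
       successively (<) (map fst T) \<and> (\<forall>s \<in> set (map fst T). h1 \<le> s \<and> s \<le> h2)}"

definition max_dissim :: "'a list \<Rightarrow> 'b list \<Rightarrow> (nat \<Rightarrow> nat \<Rightarrow> nat) \<Rightarrow> nat" where
  "max_dissim A B d = Max {d i j | i j. i \<in> {1..length A} \<and> j \<in> {1..length B}}"

definition r_val :: "'a list \<Rightarrow> nat \<Rightarrow> nat \<Rightarrow> int" where
  "r_val A i j = (int j - 1) * (2 * int (length A) - 1) + int i"

definition rt_val :: "'a list \<Rightarrow> nat \<Rightarrow> nat \<Rightarrow> int" where
  "rt_val A i j = (int j - 1) * (2 * int (length A) - 1) - int i + 2"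

definition r_pos :: "'b list \<Rightarrow> nat \<Rightarrow> nat \<Rightarrow> nat" where
  "r_pos B i j = (i - 1) * (2 * length B - 1) + j"

definition rt_pos :: "'b list \<Rightarrow> nat \<Rightarrow> nat \<Rightarrow> nat" where
  "rt_pos B i j = (i - 1) * (2 * length B - 1) + 2 - j"

(* Pairs (position, (element, weight)). *)
definition R_entries ::
  "'a list \<Rightarrow> 'b list \<Rightarrow> (nat \<Rightarrow> nat \<Rightarrow> nat) \<Rightarrow> (nat \<times> int \<times> int) set" where
  "R_entries A B d =
     {(r_pos B i j, r_val A i j, int (max_dissim A B d) - int (d i j)) | i j.
        i \<in> {1..length A} \<and> j \<in> {1..length B}} \<union>
     {(rt_pos B i j, rt_val A i j, int (max_dissim A B d)) | i j.
        i \<in> {2..length A} \<and> j \<in> {2..length B}}"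

definition R_length :: "'a list \<Rightarrow> 'b list \<Rightarrow> nat" where
  "R_length A B = length A * length B + (length A - 1) * (length B - 1)"

(* Every position 1, ..., R_length A B carries exactly one entry (R_entries_ex1), so THE is
   well defined; R_seq_nth_r and R_seq_nth_rt give the resulting elements. *)
definition R_seq :: "'a list \<Rightarrow> 'b list \<Rightarrow> (nat \<Rightarrow> nat \<Rightarrow> nat) \<Rightarrow> (int \<times> int) list" where
  "R_seq A B d = map (\<lambda>p. THE x. (p, x) \<in> R_entries A B d) [1..<R_length A B + 1]"

lemma r_pos_divmod:
  assumes "i \<in> {1..length A}" "j \<in> {1..length B}"
  shows "(r_pos B i j - 1) div (2 * length B - 1) = i - 1"
    and "(r_pos B i j - 1) mod (2 * length B - 1) = j - 1"
proof -
  have "r_pos B i j - 1 = (i - 1) * (2 * length B - 1) + (j - 1)"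
    using assms by (simp add: r_pos_def)
  moreover have "j - 1 < 2 * length B - 1"
    using assms by auto
  ultimately show "(r_pos B i j - 1) div (2 * length B - 1) = i - 1"
    "(r_pos B i j - 1) mod (2 * length B - 1) = j - 1"
    by simp_all
qed

lemma rt_pos_divmod:
  assumes "i \<in> {2..length A}" "j \<in> {2..length B}"
  shows "(rt_pos B i j - 1) div (2 * length B - 1) = i - 2"
    and "(rt_pos B i j - 1) mod (2 * length B - 1) = 2 * length B - j"
proof -
  obtain i' where i': "i = i' + 2"
    using assms(1) by (metis atLeastAtMost_iff le_add_diff_inverse2)
  have "rt_pos B i j - 1 = i' * (2 * length B - 1) + (2 * length B - j)"
    using assms(2) by (simp add: rt_pos_def i')
  moreover have "2 * length B - j < 2 * length B - 1"
    using assms(2) by auto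
  ultimately show "(rt_pos B i j - 1) div (2 * length B - 1) = i - 2"
    "(rt_pos B i j - 1) mod (2 * length B - 1) = 2 * length B - j"
    by (simp_all add: i')
qed

lemma R_length_eq:
  assumes "A \<noteq> []" "B \<noteq> []"
  shows "R_length A B = (length A - 1) * (2 * length B - 1) + length B"
proof -
  obtain a b where "length A = Suc a" "length B = Suc b"
    using assms by (metis length_0_conv not0_implies_Suc)
  then show ?thesis by (simp add: R_length_def algebra_simps)
qed

lemma R_entries_unique:
  assumes x: "(p, x) \<in> R_entries A B d" and y: "(p, y) \<in> R_entries A B d"
  shows "x = y"
proof -
  let ?n = "2 * length B - 1"
  have key: "\<exists>i j. (i \<in> {1..length A} \<and> j \<in> {1..length B} \<and>
        (p - 1) div ?n = i - 1 \<and> (p - 1) mod ?n = j - 1 \<and>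
        z = (r_val A i j, int (max_dissim A B d) - int (d i j))) \<or>
      (i \<in> {2..length A} \<and> j \<in> {2..length B} \<and>
        (p - 1) div ?n = i - 2 \<and> (p - 1) mod ?n = 2 * length B - j \<and>
        z = (rt_val A i j, int (max_dissim A B d)))"
    if z: "(p, z) \<in> R_entries A B d" for z
  proof -
    consider i j where "i \<in> {1..length A}" "j \<in> {1..length B}" "p = r_pos B i j"
        "z = (r_val A i j, int (max_dissim A B d) - int (d i j))"
      | i j where "i \<in> {2..length A}" "j \<in> {2..length B}" "p = rt_pos B i j"
        "z = (rt_val A i j, int (max_dissim A B d))"
      using z unfolding R_entries_def by blast
    then show ?thesis
    proof cases
      case 1
      then show ?thesis using r_pos_divmod[of i A j B] by blast
    next
      case 2
      then show ?thesis using rt_pos_divmod[of i A j B] by blast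
    qed
  qed
  obtain i j where ij: "(i \<in> {1..length A} \<and> j \<in> {1..length B} \<and>
        (p - 1) div ?n = i - 1 \<and> (p - 1) mod ?n = j - 1 \<and>
        x = (r_val A i j, int (max_dissim A B d) - int (d i j))) \<or>
      (i \<in> {2..length A} \<and> j \<in> {2..length B} \<and>
        (p - 1) div ?n = i - 2 \<and> (p - 1) mod ?n = 2 * length B - j \<and>
        x = (rt_val A i j, int (max_dissim A B d)))"
    using key[OF x] by blast
  obtain k l where kl: "(k \<in> {1..length A} \<and> l \<in> {1..length B} \<and>
        (p - 1) div ?n = k - 1 \<and> (p - 1) mod ?n = l - 1 \<and>
        y = (r_val A k l, int (max_dissim A B d) - int (d k l))) \<or>
      (k \<in> {2..length A} \<and> l \<in> {2..length B} \<and>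
        (p - 1) div ?n = k - 2 \<and> (p - 1) mod ?n = 2 * length B - l \<and>
        y = (rt_val A k l, int (max_dissim A B d)))"
    using key[OF y] by blast
  have small: "j - 1 < length B" if "j \<in> {1..length B}" for j
    using that by auto
  have large: "\<not> 2 * length B - j < length B" if "j \<in> {2..length B}" for j
    using that by auto
  show ?thesis
  proof (cases "(p - 1) mod ?n < length B")
    case True
    have 1: "i \<in> {1..length A}" "j \<in> {1..length B}" "(p - 1) div ?n = i - 1"
        "(p - 1) mod ?n = j - 1" "x = (r_val A i j, int (max_dissim A B d) - int (d i j))"
      using ij True large[of j] by metis+
    have 2: "k \<in> {1..length A}" "l \<in> {1..length B}" "(p - 1) div ?n = k - 1"
        "(p - 1) mod ?n = l - 1" "y = (r_val A k l, int (max_dissim A B d) - int (d k l))"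
      using kl True large[of l] by metis+
    have "i - 1 = k - 1" "j - 1 = l - 1" by (metis 1(3) 2(3), metis 1(4) 2(4))
    then have "i = k" "j = l" using 1(1,2) 2(1,2) unfolding atLeastAtMost_iff by linarith+
    with 1(5) 2(5) show ?thesis by simp
  next
    case False
    have 1: "i \<in> {2..length A}" "j \<in> {2..length B}" "(p - 1) div ?n = i - 2"
        "(p - 1) mod ?n = 2 * length B - j" "x = (rt_val A i j, int (max_dissim A B d))"
      using ij False small[of j] by metis+
    have 2: "k \<in> {2..length A}" "l \<in> {2..length B}" "(p - 1) div ?n = k - 2"
        "(p - 1) mod ?n = 2 * length B - l" "y = (rt_val A k l, int (max_dissim A B d))"
      using kl False small[of l] by metis+
    have "i - 2 = k - 2" "2 * length B - j = 2 * length B - l"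
      by (metis 1(3) 2(3), metis 1(4) 2(4))
    then have "i = k" "j = l" using 1(1,2) 2(1,2) unfolding atLeastAtMost_iff by linarith+
    with 1(5) 2(5) show ?thesis by simp
  qed
qed

lemma R_entries_pos:
  assumes "(p, x) \<in> R_entries A B d"
  shows "p \<in> {1..R_length A B}"
proof -
  let ?n = "2 * length B - 1"
  have ne: "A \<noteq> []" "B \<noteq> []"
    using assms by (auto simp: R_entries_def)
  consider i j where "i \<in> {1..length A}" "j \<in> {1..length B}" "p = r_pos B i j"
    | i j where "i \<in> {2..length A}" "j \<in> {2..length B}" "p = rt_pos B i j"
    using assms unfolding R_entries_def by blast
  then show ?thesis
  proof cases
    case 1
    then have "(i - 1) * ?n \<le> (length A - 1) * ?n"
      by (intro mult_right_mono) auto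
    with 1 show ?thesis
      by (auto simp: R_length_eq[OF ne] r_pos_def intro: add_mono)
  next
    case 2
    then have a: "(i - 1) * ?n \<le> (length A - 1) * ?n" "1 * ?n \<le> (i - 1) * ?n"
      by (intro mult_right_mono; auto)+
    moreover have "?n \<ge> j" "2 \<le> j" "1 \<le> length B" using 2 by auto
    moreover have "p = (i - 1) * ?n + 2 - j" using 2 by (simp add: rt_pos_def)
    ultimately have "1 \<le> p \<and> p \<le> (length A - 1) * ?n + length B" by linarith
    then show ?thesis by (simp add: R_length_eq[OF ne])
  qed
qed

lemma R_entries_ex:
  assumes ne: "A \<noteq> []" "B \<noteq> []" and p: "p \<in> {1..R_length A B}"
  shows "\<exists>x. (p, x) \<in> R_entries A B d"
proof -
  define n where "n = 2 * length B - 1"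
  define q where "q = (p - 1) div n"
  define m where "m = (p - 1) mod n"
  have b: "length B \<ge> 1" and a: "length A \<ge> 1"
    using ne by (auto simp: Suc_le_eq)
  then have n: "n > 0" unfolding n_def by linarith
  have pq: "p = q * n + m + 1"
    using p by (auto simp: q_def m_def)
  have m: "m < n" using n by (simp add: m_def)
  have le: "q * n + m + 1 \<le> (length A - 1) * n + length B"
    using p R_length_eq[OF ne] pq by (simp add: n_def)
  have qa: "q \<le> length A - 1"
  proof (rule ccontr)
    assume "\<not> q \<le> length A - 1"
    then have "(length A - 1 + 1) * n \<le> q * n"
      by (intro mult_right_mono) auto
    with le b have "n < length B" by (simp add: algebra_simps)
    then show False using b n_def by linarith
  qed
  show ?thesis
  proof (cases "m < length B")
    case True
    have "p = r_pos B (q + 1) (m + 1)"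
      using pq by (simp add: r_pos_def n_def)
    moreover have "q + 1 \<in> {1..length A}" "m + 1 \<in> {1..length B}"
      using qa a True by auto
    ultimately show ?thesis unfolding R_entries_def by blast
  next
    case False
    have "q \<noteq> length A - 1" using le False by auto
    then have q: "q + 2 \<in> {2..length A}" using qa by auto
    have j: "2 * length B - m \<in> {2..length B}" using False m n_def by auto
    have "rt_pos B (q + 2) (2 * length B - m) = (q + 1) * n + 2 - (2 * length B - m)"
      by (simp add: rt_pos_def n_def)
    also have "\<dots> = q * n + (n + 2 - (2 * length B - m))"
      using j n_def by (auto simp: algebra_simps)
    also have "\<dots> = p"
      using pq m b n_def by auto
    finally show ?thesis using q j unfolding R_entries_def by blast
  qed
qed

lemma R_entries_ex1:
  assumes "A \<noteq> []" "B \<noteq> []" "p \<in> {1..R_length A B}"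
  shows "\<exists>!x. (p, x) \<in> R_entries A B d"
  using R_entries_ex[OF assms] R_entries_unique by blast

lemma length_R_seq [simp]: "length (R_seq A B d) = R_length A B"
  by (simp add: R_seq_def)

lemma R_seq_nth:
  assumes "(p, x) \<in> R_entries A B d"
  shows "R_seq A B d ! (p - 1) = x"
proof -
  have "(THE y. (p, y) \<in> R_entries A B d) = x"
    using assms R_entries_unique by blast
  then show ?thesis
    using R_entries_pos[OF assms] by (auto simp: R_seq_def nth_append simp del: upt_Suc)
qed

lemma R_seq_nth_r:
  assumes "i \<in> {1..length A}" "j \<in> {1..length B}"
  shows "R_seq A B d ! (r_pos B i j - 1) = (r_val A i j, int (max_dissim A B d) - int (d i j))"
  using assms by (intro R_seq_nth) (auto simp: R_entries_def)

lemma R_seq_nth_rt: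
  assumes "i \<in> {2..length A}" "j \<in> {2..length B}"
  shows "R_seq A B d ! (rt_pos B i j - 1) = (rt_val A i j, int (max_dissim A B d))"
  using assms by (intro R_seq_nth) (auto simp: R_entries_def)

end

theory Submission
  imports Defs
begin

text \<open>
  View the entry \<open>r(i, j)\<close> as the cell \<open>(i, j)\<close> of the alignment grid and the entry
  \<open>r~(i + 1, j + 1)\<close> as the diagonal step from \<open>(i, j)\<close> to \<open>(i + 1, j + 1)\<close>. Then one entry
  precedes another both in position and in value exactly if a monotone path can visit them in this
  order, and the windows in position and value bound the path's end points. An alignment using
  \<open>s\<close> diagonal steps has \<open>m + n - 1 - s\<close> cells, so its cells and diagonal steps form an increasing
  subsequence of weight exactly \<open>c (m + n - 1)\<close> minus its discrepancy. Conversely, every increasing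
  subsequence extends to an alignment, and the added entries have nonnegative weight.
\<close>

section \<open>Grid entries and the path order\<close>

text \<open>\<open>Diag i j\<close> is the entry \<open>r~(i + 1, j + 1)\<close>: the indices are those of the step's source.\<close>

datatype node = Cell nat nat | Diag nat nat

fun src :: "node \<Rightarrow> nat \<times> nat" where
  "src (Cell i j) = (i, j)"
| "src (Diag i j) = (i, j)"

fun tgt :: "node \<Rightarrow> nat \<times> nat" where
  "tgt (Cell i j) = (i, j)"
| "tgt (Diag i j) = (i + 1, j + 1)"

fun transposed :: "node \<Rightarrow> node" where
  "transposed (Cell i j) = Cell j i"
| "transposed (Diag i j) = Diag j i"

fun weight :: "nat \<Rightarrow> (nat \<Rightarrow> nat \<Rightarrow> nat) \<Rightarrow> node \<Rightarrow> int" where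
  "weight c d (Cell i j) = int c - int (d i j)"
| "weight c d (Diag i j) = int c"

text \<open>
  \<open>rank (length B) x\<close> is the position of an entry in \<open>R_seq A B d\<close>. The construction is symmetric
  in \<open>A\<close> and \<open>B\<close>, so its value is \<open>rank (length A) (transposed x)\<close>.
\<close>

fun rank :: "nat \<Rightarrow> node \<Rightarrow> int" where
  "rank n (Cell i j) = (int i - 1) * (2 * int n - 1) + int j"
| "rank n (Diag i j) = int i * (2 * int n - 1) + 1 - int j"

text \<open>The path order. Source and target of a cell coincide, so \<open>x \<noteq> y\<close> is
  what makes the relation irreflexive on cells.\<close>

definition prec :: "node \<Rightarrow> node \<Rightarrow> bool" where
  "prec x y \<longleftrightarrow> x \<noteq> y \<and> fst (tgt x) \<le> fst (src y) \<and> snd (tgt x) \<le> snd (src y)"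

definition within :: "nat \<Rightarrow> nat \<Rightarrow> nat \<Rightarrow> nat \<Rightarrow> node \<Rightarrow> bool" where
  "within i1 i2 j1 j2 x \<longleftrightarrow>
     i1 \<le> fst (src x) \<and> fst (tgt x) \<le> i2 \<and> j1 \<le> snd (src x) \<and> snd (tgt x) \<le> j2"

lemma within_transposed: "within j1 j2 i1 i2 (transposed x) \<longleftrightarrow> within i1 i2 j1 j2 x"
  by (cases x) (auto simp: within_def)

section \<open>Ranks compared with the path order\<close>

text \<open>
  \<open>R_seq A B d\<close> splits into blocks of \<open>2 * length B - 1\<close> entries with the same source row: first
  the cells from left to right, then the diagonal steps from right to left.
\<close>

fun offset :: "nat \<Rightarrow> node \<Rightarrow> int" where
  "offset n (Cell i j) = int j"
| "offset n (Diag i j) = 2 * int n - int j"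

lemma rank_eq: "rank n x = (int (fst (src x)) - 1) * (2 * int n - 1) + offset n x"
  by (cases x) (auto simp: algebra_simps)

lemma offset_bounds:
  assumes "within 1 m 1 n x"
  shows "1 \<le> offset n x" "offset n x \<le> 2 * int n - 1"
  using assms by (cases x; auto simp: within_def)+

lemma lex_less:
  fixes p q u v N :: int
  assumes "p < q" "1 \<le> v" "u \<le> N" "1 \<le> N"
  shows "p * N + u < q * N + v"
proof -
  have "(p + 1) * N \<le> q * N"
    using assms by (intro mult_right_mono) auto
  then have "p * N + N \<le> q * N"
    by (simp add: algebra_simps)
  with assms show ?thesis by linarith
qed

text \<open>By \<open>offset_bounds\<close>, a rank is a two-digit numeral in base
  \<open>2 * n - 1\<close>, with the source row leading and digits 1 to \<open>2 * n - 1\<close>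
  last, so ranks compare lexicographically.\<close>

lemma rank_le_iff:
  assumes "within 1 m 1 n x" "within 1 m 1 n y"
  shows "rank n x \<le> rank n y \<longleftrightarrow> fst (src x) < fst (src y) \<or>
           fst (src x) = fst (src y) \<and> offset n x \<le> offset n y"
proof -
  note b = offset_bounds[OF assms(1)] offset_bounds[OF assms(2)]
  then have N: "1 \<le> 2 * int n - 1" by linarith
  consider "fst (src x) < fst (src y)" | "fst (src x) = fst (src y)" | "fst (src y) < fst (src x)"
    by linarith
  then show ?thesis
  proof cases
    case 1
    with lex_less[of "int (fst (src x)) - 1" "int (fst (src y)) - 1" "offset n y"
        "offset n x" "2 * int n - 1"] b N
    show ?thesis by (simp add: rank_eq)
  next
    case 3
    with lex_less[of "int (fst (src y)) - 1" "int (fst (src x)) - 1" "offset n x"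
        "offset n y" "2 * int n - 1"] b N
    show ?thesis by (simp add: rank_eq)
  qed (simp add: rank_eq)
qed

lemma rank_transposed_le_iff:
  assumes "within 1 m 1 n x" "within 1 m 1 n y"
  shows "rank m (transposed x) \<le> rank m (transposed y) \<longleftrightarrow> snd (src x) < snd (src y) \<or>
           snd (src x) = snd (src y) \<and> offset m (transposed x) \<le> offset m (transposed y)"
  using rank_le_iff[of n m "transposed x" "transposed y"] assms
  by (cases x; cases y) (auto simp: within_transposed within_def)

text \<open>The layout of the blocks matters when sources share a row or column. Two distinct steps
  from one row are ordered oppositely by position and by value, as no path takes both; and since
  cells come first in a block, no cell follows a step from its own row.\<close>

lemma rank_le_and_le_iff:
  assumes "within 1 m 1 n x" "within 1 m 1 n y"
  shows "rank n x \<le> rank n y \<and> rank m (transposed x) \<le> rank m (transposed y) \<longleftrightarrow>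
           x = y \<or> prec x y"
  unfolding rank_le_iff[OF assms] rank_transposed_le_iff[OF assms]
  using assms by (cases x; cases y) (auto simp: prec_def within_def)

text \<open>The weak form serves the window bounds, which an entry may attain; this strict form
  serves the elements of an increasing subsequence.\<close>

lemma rank_less_and_less_iff:
  assumes "within 1 m 1 n x" "within 1 m 1 n y"
  shows "rank n x < rank n y \<and> rank m (transposed x) < rank m (transposed y) \<longleftrightarrow> prec x y"
  unfolding not_le[symmetric] rank_le_iff[OF assms(2,1)] rank_transposed_le_iff[OF assms(2,1)]
  using assms by (cases x; cases y) (auto simp: prec_def within_def)

text \<open>On valid entries \<open>prec\<close> is the intersection of two strict rank orders,
  hence transitive.\<close>

lemma sorted_wrt_prec:
  assumes "successively prec X" "\<And>x. x \<in> set X \<Longrightarrow> within 1 m 1 n x"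
  shows "sorted_wrt prec X"
proof -
  have "prec x z" if "x \<in> set X" "y \<in> set X" "z \<in> set X" "prec x y" "prec y z" for x y z
    using that assms(2) rank_less_and_less_iff[of m n] by (meson order.strict_trans)
  then show ?thesis
    using assms(1) successively_iff_sorted_wrt_strong by blast
qed

text \<open>Pairing the two lower bounds says that \<open>x\<close> equals or follows the lower
  corner cell in path order; the two upper bounds do the same for the upper corner.\<close>

lemma within_iff_rank:
  assumes "within 1 m 1 n x" "1 \<le> i1" "i1 \<le> i2" "i2 \<le> m" "1 \<le> j1" "j1 \<le> j2" "j2 \<le> n"
  shows "within i1 i2 j1 j2 x \<longleftrightarrow>
    rank n (Cell i1 j1) \<le> rank n x \<and> rank n x \<le> rank n (Cell i2 j2) \<and>
    rank m (Cell j1 i1) \<le> rank m (transposed x) \<and> rank m (transposed x) \<le> rank m (Cell j2 i2)"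
proof -
  have "within 1 m 1 n (Cell i1 j1)" "within 1 m 1 n (Cell i2 j2)"
    using assms by (auto simp: within_def)
  then have "rank n (Cell i1 j1) \<le> rank n x \<and> rank m (Cell j1 i1) \<le> rank m (transposed x) \<longleftrightarrow>
      x = Cell i1 j1 \<or> prec (Cell i1 j1) x"
    "rank n x \<le> rank n (Cell i2 j2) \<and> rank m (transposed x) \<le> rank m (Cell j2 i2) \<longleftrightarrow>
      x = Cell i2 j2 \<or> prec x (Cell i2 j2)"
    using rank_le_and_le_iff[of m n x "Cell i2 j2"] rank_le_and_le_iff[of m n "Cell i1 j1" x]
      assms(1) by auto
  moreover have "within i1 i2 j1 j2 x \<longleftrightarrow>
      (x = Cell i1 j1 \<or> prec (Cell i1 j1) x) \<and> (x = Cell i2 j2 \<or> prec x (Cell i2 j2))"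
    using assms by (cases x) (auto simp: prec_def within_def)
  ultimately show ?thesis by blast
qed

section \<open>Alignments and chains of entries\<close>

lemma alignment_Cons:
  assumes "alignment k i2 l j2 P" "(k, l) \<in> {(i + 1, j + 1), (i + 1, j), (i, j + 1)}"
  shows "alignment i i2 j j2 ((i, j) # P)"
  using assms by (cases P) (auto simp: alignment_def)

text \<open>A move adds as many entries as it raises \<open>i + j\<close>: two if diagonal, one
  otherwise. Each is worth \<open>c\<close> once discrepancy is added back, whence equality. The
  claim on \<open>hd X\<close> lets the induction prepend entries.\<close>

lemma chain_of_alignment:
  assumes "alignment i i2 j j2 P"
  shows "\<exists>X. X \<noteq> [] \<and> hd X = Cell i j \<and> successively prec X \<and>
    (\<forall>x\<in>set X. within i i2 j j2 x) \<and> i \<le> i2 \<and> j \<le> j2 \<and>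
    sum_list (map (weight c d) X) + int (discrepancy d P) = int c * int (i2 - i + (j2 - j) + 1)"
  using assms
proof (induction P arbitrary: i j)
  case Nil
  then show ?case by (simp add: alignment_def)
next
  case (Cons p P)
  then have p: "p = (i, j)" by (simp add: alignment_def)
  show ?case
  proof (cases P)
    case Nil
    with Cons.prems p show ?thesis
      by (intro exI[of _ "[Cell i j]"]) (auto simp: alignment_def within_def discrepancy_def)
  next
    case (Cons q Q)
    obtain k l where q: "q = (k, l)" by fastforce
    have al: "alignment k i2 l j2 P" and
      step: "(k, l) \<in> {(i + 1, j + 1), (i + 1, j), (i, j + 1)}"
      using Cons.prems by (auto simp: alignment_def Cons q p)
    obtain X where X: "X \<noteq> []" "hd X = Cell k l" "successively prec X"
      "\<forall>x\<in>set X. within k i2 l j2 x" "k \<le> i2" "l \<le> j2"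
      "sum_list (map (weight c d) X) + int (discrepancy d P) = int c * int (i2 - k + (j2 - l) + 1)"
      using Cons.IH[OF al] by blast
    define Y where "Y = Cell i j # (if (k, l) = (i + 1, j + 1) then [Diag i j] else []) @ X"
    have disc: "discrepancy d (p # P) = d i j + discrepancy d P"
      by (simp add: discrepancy_def p)
    have "successively prec Y"
      using X(1-3) step by (auto simp: Y_def successively_Cons prec_def)
    moreover have "\<forall>x\<in>set Y. within i i2 j j2 x"
      using X(4-6) step by (auto simp: Y_def within_def)
    moreover have "sum_list (map (weight c d) Y) + int (discrepancy d (p # P)) =
        int c * int (i2 - i + (j2 - j) + 1)"
    proof (cases "(k, l) = (i + 1, j + 1)")
      case True
      then have "i2 - i + (j2 - j) + 1 = i2 - k + (j2 - l) + 1 + 2" using X(5,6) by auto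
      then have "int c * int (i2 - i + (j2 - j) + 1) = int c * int (i2 - k + (j2 - l) + 1) + 2 * int c"
        by (simp only: of_nat_add) (simp add: algebra_simps)
      with True X(7) show ?thesis by (simp add: Y_def disc)
    next
      case False
      then have "i2 - i + (j2 - j) + 1 = i2 - k + (j2 - l) + 1 + 1" using X(5,6) step by auto
      then have "int c * int (i2 - i + (j2 - j) + 1) = int c * int (i2 - k + (j2 - l) + 1) + int c"
        by (simp only: of_nat_add) (simp add: algebra_simps)
      with False X(7) show ?thesis by (auto simp: Y_def disc)
    qed
    moreover have "i \<le> i2" "j \<le> j2" using X(5,6) step by auto
    ultimately show ?thesis
      by (intro exI[of _ Y]) (auto simp: Y_def)
  qed
qed

lemma alignment_of_chain:
  assumes "i \<le> i2" "j \<le> j2" "sorted_wrt prec X" "\<forall>x\<in>set X. within i i2 j j2 x"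
    and "\<And>k l. k \<in> {i..i2} \<Longrightarrow> l \<in> {j..j2} \<Longrightarrow> d k l \<le> c"
  shows "\<exists>P. alignment i i2 j j2 P \<and>
    sum_list (map (weight c d) X) + int (discrepancy d P) \<le> int c * int (i2 - i + (j2 - j) + 1)"
  using assms
proof (induction "i2 - i + (j2 - j)" arbitrary: i j X rule: less_induct)
  case less
  have dij: "d i j \<le> c" using less.prems by auto
  \<comment> \<open>Prolonging a path from \<open>(k, l)\<close> backwards to \<open>(i, j)\<close>
    costs \<open>d i j\<close>.\<close>
  have step: "\<exists>P. alignment i i2 j j2 P \<and>
      sum_list (map (weight c d) Y) + int (discrepancy d P) \<le>
        int c * int (i2 - k + (j2 - l) + 1) + int (d i j)"
    if kl: "(k, l) \<in> {(i + 1, j + 1), (i + 1, j), (i, j + 1)}" and le: "k \<le> i2" "l \<le> j2"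
      and Y: "sorted_wrt prec Y" "\<forall>x\<in>set Y. within k i2 l j2 x" for k l Y
  proof -
    have "i2 - k + (j2 - l) < i2 - i + (j2 - j)" using kl le by auto
    moreover have "d k' l' \<le> c" if "k' \<in> {k..i2}" "l' \<in> {l..j2}" for k' l'
      using that kl by (intro less.prems(5)) auto
    ultimately obtain P where "alignment k i2 l j2 P"
      "sum_list (map (weight c d) Y) + int (discrepancy d P) \<le> int c * int (i2 - k + (j2 - l) + 1)"
      using less.hyps[of k l Y] le Y by blast
    with kl show ?thesis
      by (intro exI[of _ "(i, j) # P"]) (auto simp: discrepancy_def intro: alignment_Cons)
  qed
  \<comment> \<open>Here one \<open>c\<close> is held back for the corner cell: either that cell is
    in the chain and has weight \<open>c - d i j\<close>, or \<open>d i j \<le> c\<close> pays for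
    adding it.\<close>
  have strict: "\<exists>P. alignment i i2 j j2 P \<and>
      sum_list (map (weight c d) Y) + int (discrepancy d P) \<le>
        int c * int (i2 - i + (j2 - j)) + int (d i j)"
    if Y: "sorted_wrt prec Y" "\<forall>y\<in>set Y. within i i2 j j2 y \<and> y \<noteq> Cell i j" for Y
  proof -
    \<comment> \<open>The first entry decides the first move: later entries lie beyond its target,
      so unless it is \<open>Diag i j\<close>, the whole chain avoids row \<open>i\<close> or column
      \<open>j\<close>.\<close>
    consider "Y = []" "i = i2" "j = j2"
      | Z where "Y = Diag i j # Z"
      | "i + 1 \<le> i2" "\<forall>y\<in>set Y. within (i + 1) i2 j j2 y"
      | "j + 1 \<le> j2" "\<forall>y\<in>set Y. within i i2 (j + 1) j2 y"
    proof (cases Y)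
      case Nil
      with that less.prems(1,2) show ?thesis by force
    next
      case (Cons y Z)
      have le: "fst (tgt y) \<le> fst (src z) \<and> snd (tgt y) \<le> snd (src z)" if "z \<in> set Z" for z
        using Y(1) that by (auto simp: Cons prec_def)
      have y: "within i i2 j j2 y" "y \<noteq> Cell i j" using Y(2) Cons by auto
      show ?thesis
      proof (cases "y = Diag i j")
        case True
        with that(2) Cons show ?thesis by blast
      next
        case False
        with y have "i + 1 \<le> fst (src y) \<or> j + 1 \<le> snd (src y)"
          by (cases y) (auto simp: within_def)
        moreover have "fst (src y) \<le> fst (tgt y)" "snd (src y) \<le> snd (tgt y)"
          by (cases y; simp)+
        ultimately show ?thesis
          using that(3,4) Y(2) le y(1) unfolding Cons within_def
          by (auto; fastforce)
      qed
    qed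
    then show ?thesis
    proof cases
      case 1
      then show ?thesis
        by (intro exI[of _ "[(i, j)]"]) (auto simp: alignment_def discrepancy_def)
    next
      case 2
      have ij: "i + 1 \<le> i2" "j + 1 \<le> j2" using Y(2) by (auto simp: 2 within_def)
      have "\<forall>x\<in>set Z. within (i + 1) i2 (j + 1) j2 x"
        using Y by (auto simp: 2 within_def prec_def)
      with step[of "i + 1" "j + 1" Z] ij Y(1) obtain P where P: "alignment i i2 j j2 P"
        "sum_list (map (weight c d) Z) + int (discrepancy d P) \<le>
          int c * int (i2 - (i + 1) + (j2 - (j + 1)) + 1) + int (d i j)"
        by (auto simp: 2)
      \<comment> \<open>A diagonal move shortens the distance by two: one \<open>c\<close> pays for
        \<open>Diag i j\<close>, the other is the \<open>+ 1\<close> of the smaller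
        rectangle.\<close>
      have "i2 - i + (j2 - j) = i2 - (i + 1) + (j2 - (j + 1)) + 1 + 1" using ij by linarith
      then have "int c * int (i2 - i + (j2 - j)) =
          int c * int (i2 - (i + 1) + (j2 - (j + 1)) + 1) + int c"
        by (simp only: of_nat_add) (simp add: algebra_simps)
      with P show ?thesis by (intro exI[of _ P]) (simp add: 2)
    next
      case 3
      then have eq: "i2 - (i + 1) + (j2 - j) + 1 = i2 - i + (j2 - j)" by linarith
      show ?thesis
        using step[of "i + 1" j Y] 3 Y(1) less.prems(2) unfolding eq by blast
    next
      case 4
      then have eq: "i2 - i + (j2 - (j + 1)) + 1 = i2 - i + (j2 - j)" by linarith
      show ?thesis
        using step[of i "j + 1" Y] 4 Y(1) less.prems(1) unfolding eq by blast
    qed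
  qed
  have eq: "int c * int (i2 - i + (j2 - j) + 1) = int c * int (i2 - i + (j2 - j)) + int c"
    by (simp only: of_nat_add) (simp add: algebra_simps)
  show ?case
  proof (cases "Cell i j \<in> set X")
    case False
    with strict[OF less.prems(3)] less.prems(4) obtain P where "alignment i i2 j j2 P"
      "sum_list (map (weight c d) X) + int (discrepancy d P) \<le>
        int c * int (i2 - i + (j2 - j)) + int (d i j)"
      by blast
    with dij eq show ?thesis by (intro exI[of _ P]) auto
  next
    case True
    then obtain x Y where X: "X = x # Y" by (cases X) auto
    \<comment> \<open>Nothing inside the rectangle precedes its corner cell.\<close>
    have x: "x = Cell i j"
    proof (rule ccontr)
      assume "x \<noteq> Cell i j"
      then have "prec x (Cell i j)" using True less.prems(3) by (auto simp: X)
      moreover have "within i i2 j j2 x" using less.prems(4) by (simp add: X)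
      ultimately show False by (cases x) (auto simp: prec_def within_def)
    qed
    have "Cell i j \<notin> set Y" using less.prems(3) by (auto simp: X x prec_def)
    with strict[of Y] less.prems(3,4) obtain P where "alignment i i2 j j2 P"
      "sum_list (map (weight c d) Y) + int (discrepancy d P) \<le>
        int c * int (i2 - i + (j2 - j)) + int (d i j)"
      by (auto simp: X)
    with eq show ?thesis by (intro exI[of _ P]) (auto simp: X x)
  qed
qed

section \<open>Banded increasing subsequences as chains\<close>

text \<open>Represents a subsequence by its increasing positions, which can then be compared as
  ranks.\<close>

lemma subseq_slice_iff:
  "subseq T (slice S a b) \<longleftrightarrow>
     (\<exists>ps. sorted_wrt (<) ps \<and> set ps \<subseteq> {a..b} \<and> T = map (\<lambda>p. S ! (p - 1)) ps)"
proof
  assume "subseq T (slice S a b)"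
  then obtain N where "T = map (\<lambda>p. S ! (p - 1)) (nths [a..<b + 1] N)"
    by (auto simp: subseq_conv_nths slice_def nths_map)
  moreover have "sorted_wrt (<) (nths [a..<b + 1] N)"
    by (simp add: strict_sorted_iff sorted_nths distinct_nthsI del: upt_Suc)
  moreover have "set (nths [a..<b + 1] N) \<subseteq> {a..b}"
    using set_nths_subset[of "[a..<b + 1]" N] by auto
  ultimately show "\<exists>ps. sorted_wrt (<) ps \<and> set ps \<subseteq> {a..b} \<and> T = map (\<lambda>p. S ! (p - 1)) ps"
    by blast
next
  assume "\<exists>ps. sorted_wrt (<) ps \<and> set ps \<subseteq> {a..b} \<and> T = map (\<lambda>p. S ! (p - 1)) ps"
  then obtain ps where ps: "sorted_wrt (<) ps" "set ps \<subseteq> {a..b}"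
    "T = map (\<lambda>p. S ! (p - 1)) ps" by blast
  \<comment> \<open>A strictly sorted list is determined by its set.\<close>
  have "filter (\<lambda>p. p \<in> set ps) [a..<b + 1] = ps"
    using ps(1,2)
    by (intro sorted_distinct_set_unique)
       (auto simp: strict_sorted_iff sorted_wrt_filter simp del: upt_Suc)
  then have "subseq ps [a..<b + 1]"
    by (metis subseq_filter_left)
  then show "subseq T (slice S a b)"
    unfolding slice_def ps(3) by (rule subseq_map)
qed

lemma r_pos_rank:
  assumes "1 \<le> i" "1 \<le> length B"
  shows "r_pos B i j = nat (rank (length B) (Cell i j))"
proof -
  have "int (r_pos B i j) = rank (length B) (Cell i j)"
    using assms by (simp add: r_pos_def of_nat_diff)
  then show ?thesis by linarith
qed

lemma rt_pos_rank:
  assumes "2 \<le> i" "1 \<le> j" "j \<le> length B"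
  shows "rt_pos B i j = nat (rank (length B) (Diag (i - 1) (j - 1)))"
proof -
  \<comment> \<open>This bound keeps the natural subtraction in \<open>rt_pos\<close> from
    truncating.\<close>
  have "1 * (2 * length B - 1) \<le> (i - 1) * (2 * length B - 1)"
    using assms by (intro mult_right_mono) auto
  then have "j \<le> (i - 1) * (2 * length B - 1) + 2"
    using assms by linarith
  then have "int (rt_pos B i j) = rank (length B) (Diag (i - 1) (j - 1))"
    using assms by (simp add: rt_pos_def of_nat_diff)
  then show ?thesis by linarith
qed

lemma R_entries_eq:
  "R_entries A B d =
     (\<lambda>x. (nat (rank (length B) x), rank (length A) (transposed x), weight (max_dissim A B d) d x)) `
       {x. within 1 (length A) 1 (length B) x}" (is "_ = ?e ` ?W")
proof (intro equalityI subsetI)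
  fix z assume "z \<in> R_entries A B d"
  then consider i j where "i \<in> {1..length A}" "j \<in> {1..length B}"
      "z = (r_pos B i j, r_val A i j, int (max_dissim A B d) - int (d i j))"
    | i j where "i \<in> {2..length A}" "j \<in> {2..length B}"
      "z = (rt_pos B i j, rt_val A i j, int (max_dissim A B d))"
    unfolding R_entries_def by blast
  then show "z \<in> ?e ` ?W"
  proof cases
    case 1
    then have "z = ?e (Cell i j)" "Cell i j \<in> ?W"
      by (auto simp: r_pos_rank r_val_def within_def)
    then show ?thesis by blast
  next
    case 2
    then have "z = ?e (Diag (i - 1) (j - 1))" "Diag (i - 1) (j - 1) \<in> ?W"
      by (auto simp: rt_pos_rank rt_val_def within_def of_nat_diff)
    then show ?thesis by blast
  qed
next
  fix z assume "z \<in> ?e ` ?W"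
  then obtain x where x: "x \<in> ?W" "z = ?e x" by blast
  show "z \<in> R_entries A B d"
  proof (cases x)
    case (Cell i j)
    then have "i \<in> {1..length A}" "j \<in> {1..length B}"
      "z = (r_pos B i j, r_val A i j, int (max_dissim A B d) - int (d i j))"
      using x by (auto simp: r_pos_rank r_val_def within_def)
    then show ?thesis unfolding R_entries_def by blast
  next
    case (Diag i j)
    then have "i + 1 \<in> {2..length A}" "j + 1 \<in> {2..length B}"
      "z = (rt_pos B (i + 1) (j + 1), rt_val A (i + 1) (j + 1), int (max_dissim A B d))"
      using x by (auto simp: rt_pos_rank rt_val_def within_def)
    then show ?thesis unfolding R_entries_def by blast
  qed
qed

lemma R_seq_nth_rank:
  assumes "within 1 (length A) 1 (length B) x"
  shows "1 \<le> rank (length B) x"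
    and "R_seq A B d ! (nat (rank (length B) x) - 1) =
      (rank (length A) (transposed x), weight (max_dissim A B d) d x)"
proof -
  have *: "(nat (rank (length B) x), rank (length A) (transposed x), weight (max_dissim A B d) d x)
      \<in> R_entries A B d"
    using assms unfolding R_entries_eq by blast
  from R_entries_pos[OF *] show "1 \<le> rank (length B) x" by auto
  from R_seq_nth[OF *] show "R_seq A B d ! (nat (rank (length B) x) - 1) =
      (rank (length A) (transposed x), weight (max_dissim A B d) d x)" .
qed

text \<open>Increasing positions and increasing values together amount to \<open>prec\<close>; the
  slice and the band together amount to \<open>within\<close>.\<close>

lemma banded_subseq_iff_chain:
  fixes A :: "'a list" and B :: "'b list"
  assumes ij: "1 \<le> i1" "i1 \<le> i2" "i2 \<le> length A" "1 \<le> j1" "j1 \<le> j2" "j2 \<le> length B"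
  shows "subseq T (slice (R_seq A B d) (r_pos B i1 j1) (r_pos B i2 j2)) \<and>
      successively (<) (map fst T) \<and>
      (\<forall>s\<in>set (map fst T). r_val A i1 j1 \<le> s \<and> s \<le> r_val A i2 j2) \<longleftrightarrow>
    (\<exists>X. sorted_wrt prec X \<and> (\<forall>x\<in>set X. within i1 i2 j1 j2 x) \<and>
      T = map (\<lambda>x. (rank (length A) (transposed x), weight (max_dissim A B d) d x)) X)"
    (is "?L \<longleftrightarrow> ?R")
proof -
  let ?a = "length A" and ?b = "length B" and ?S = "R_seq A B d"
  let ?e = "\<lambda>x. (rank ?a (transposed x), weight (max_dissim A B d) d x)"
  let ?V = "within 1 ?a 1 ?b"
  have pos: "int (r_pos B i1 j1) = rank ?b (Cell i1 j1)"
    "int (r_pos B i2 j2) = rank ?b (Cell i2 j2)"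
    using ij by (simp_all add: r_pos_def of_nat_diff)
  have val: "r_val A i j = rank ?a (transposed (Cell i j))" for i j
    by (simp add: r_val_def)
  note within_iff = within_iff_rank[OF _ ij]
  have valid: "?V x" if "within i1 i2 j1 j2 x" for x
    using that ij by (auto simp: within_def)
  show ?thesis
  proof
    assume L: ?L
    then obtain ps where ps: "sorted_wrt (<) ps" "set ps \<subseteq> {r_pos B i1 j1..r_pos B i2 j2}"
      "T = map (\<lambda>p. ?S ! (p - 1)) ps"
      unfolding subseq_slice_iff by blast
    have ne: "A \<noteq> []" "B \<noteq> []" using ij by auto
    \<comment> \<open>The slice ends at the position of an actual entry, so all its positions are
      valid.\<close>
    have "(r_pos B i2 j2, r_val A i2 j2, int (max_dissim A B d) - int (d i2 j2)) \<in> R_entries A B d"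
      unfolding R_entries_def using ij by auto
    then have "r_pos B i2 j2 \<le> R_length A B"
      using R_entries_pos by fastforce
    moreover have "1 \<le> r_pos B i1 j1" using ij by (simp add: r_pos_def)
    ultimately have pos_ex: "\<exists>z. (p, z) \<in> R_entries A B d" if "p \<in> set ps" for p
      using R_entries_ex[OF ne, of p d] that ps(2) by force
    have "\<exists>x. ?V x \<and> p = nat (rank ?b x)" if p: "p \<in> set ps" for p
      using pos_ex[OF p] unfolding R_entries_eq by blast
    then obtain g where g: "\<And>p. p \<in> set ps \<Longrightarrow> ?V (g p) \<and> p = nat (rank ?b (g p))"
      by metis
    define X where "X = map g ps"
    have V: "?V x" if "x \<in> set X" for x using that g by (auto simp: X_def)
    have "map (\<lambda>x. nat (rank ?b x)) X = map id ps"
      unfolding X_def map_map by (rule map_cong[OF refl]) (simp add: g[THEN conjunct2, symmetric])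
    then have ps_eq: "ps = map (\<lambda>x. nat (rank ?b x)) X" by simp
    have T: "T = map ?e X"
      unfolding ps(3) ps_eq map_map
      by (rule map_cong[OF refl]) (simp only: comp_def R_seq_nth_rank(2)[OF V])
    have "sorted_wrt (\<lambda>x y. rank ?b x < rank ?b y) X"
      using ps(1) unfolding ps_eq sorted_wrt_map
      by (rule sorted_wrt_mono_rel[rotated]) linarith
    moreover have "sorted_wrt (\<lambda>x y. rank ?a (transposed x) < rank ?a (transposed y)) X"
      using L by (simp add: T successively_conv_sorted_wrt[of "(<)"] sorted_wrt_map)
    ultimately have "sorted_wrt prec X"
      using rank_less_and_less_iff[OF V V] unfolding sorted_wrt_iff_nth_less
      by (meson nth_mem order.strict_trans)
    moreover have "within i1 i2 j1 j2 x" if x: "x \<in> set X" for x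
    proof -
      have "r_pos B i1 j1 \<le> nat (rank ?b x)" "nat (rank ?b x) \<le> r_pos B i2 j2"
        using ps(2) x by (auto simp: ps_eq)
      then have "rank ?b (Cell i1 j1) \<le> rank ?b x" "rank ?b x \<le> rank ?b (Cell i2 j2)"
        using R_seq_nth_rank(1)[OF V[OF x]] pos by linarith+
      moreover have "r_val A i1 j1 \<le> rank ?a (transposed x)"
        "rank ?a (transposed x) \<le> r_val A i2 j2"
        using L x by (auto simp: T)
      ultimately show ?thesis
        using within_iff[OF V[OF x]] by (simp add: val)
    qed
    ultimately show ?R using T by blast
  next
    assume ?R
    then obtain X where X: "sorted_wrt prec X" "\<And>x. x \<in> set X \<Longrightarrow> within i1 i2 j1 j2 x"
      "T = map ?e X" by blast
    have V: "?V x" if "x \<in> set X" for x using X(2) that valid by blast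
    have less: "sorted_wrt (\<lambda>x y. rank ?b x < rank ?b y \<and>
        rank ?a (transposed x) < rank ?a (transposed y)) X"
      using X(1) by (rule sorted_wrt_mono_rel[rotated]) (simp only: rank_less_and_less_iff[OF V V])
    define ps where "ps = map (\<lambda>x. nat (rank ?b x)) X"
    \<comment> \<open>Ranks are at least 1, so \<open>nat\<close> preserves their strict
      order.\<close>
    have "sorted_wrt (<) ps"
      unfolding ps_def sorted_wrt_map using less
      by (rule sorted_wrt_mono_rel[rotated]) (use R_seq_nth_rank(1)[OF V] in force)
    moreover have "set ps \<subseteq> {r_pos B i1 j1..r_pos B i2 j2}"
    proof
      fix p assume "p \<in> set ps"
      then obtain x where x: "x \<in> set X" "p = nat (rank ?b x)" by (auto simp: ps_def)
      then show "p \<in> {r_pos B i1 j1..r_pos B i2 j2}"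
        using within_iff[OF V[OF x(1)]] X(2)[OF x(1)] pos by auto
    qed
    moreover have "T = map (\<lambda>p. ?S ! (p - 1)) ps"
      unfolding X(3) ps_def map_map
      by (rule map_cong[OF refl]) (simp only: comp_def R_seq_nth_rank(2)[OF V])
    ultimately have "subseq T (slice ?S (r_pos B i1 j1) (r_pos B i2 j2))"
      unfolding subseq_slice_iff by blast
    moreover have "successively (<) (map fst T)"
      unfolding X(3) successively_conv_sorted_wrt[OF transp_on_less] sorted_wrt_map using less
      by (rule sorted_wrt_mono_rel[rotated]) simp
    moreover have "\<forall>s\<in>set (map fst T). r_val A i1 j1 \<le> s \<and> s \<le> r_val A i2 j2"
      using within_iff V X(2) by (auto simp: X(3) val)
    ultimately show ?L by blast
  qed
qed

section \<open>Optimal alignment against heaviest chain\<close>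

theorem theorem1:
  fixes A :: "'a list" and B :: "'b list"
    and d :: "nat \<Rightarrow> nat \<Rightarrow> nat"
    and i1 i2 j1 j2 :: nat
  assumes "A \<noteq> []" and "B \<noteq> []"
    and "1 \<le> i1" and "i1 \<le> i2" and "i2 \<le> length A"
    and "1 \<le> j1" and "j1 \<le> j2" and "j2 \<le> length B"
  shows "int (dtw d i1 i2 j1 j2) =
    int (max_dissim A B d) * (int (length (slice A i1 i2)) + int (length (slice B j1 j2)) - 1)
    - banded_HIS_weight (r_val A i1 j1) (r_val A i2 j2)
        (slice (R_seq A B d) (r_pos B i1 j1) (r_pos B i2 j2))"
proof -
  let ?e = "\<lambda>x. (rank (length A) (transposed x), weight (max_dissim A B d) d x)"
  let ?R = "slice (R_seq A B d) (r_pos B i1 j1) (r_pos B i2 j2)"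
  define c where "c = max_dissim A B d"
  define N where "N = int c * int (i2 - i1 + (j2 - j1) + 1)"
  define D where "D = {discrepancy d P | P. alignment i1 i2 j1 j2 P}"
  define W where "W = {sum_list (map snd T) | T. T \<noteq> [] \<and> subseq T ?R \<and>
       successively (<) (map fst T) \<and>
       (\<forall>s\<in>set (map fst T). r_val A i1 j1 \<le> s \<and> s \<le> r_val A i2 j2)}"
  have W_iff: "w \<in> W \<longleftrightarrow> (\<exists>X. X \<noteq> [] \<and> sorted_wrt prec X \<and>
      (\<forall>x\<in>set X. within i1 i2 j1 j2 x) \<and> w = sum_list (map (weight c d) X))" for w
  proof -
    have "map snd (map ?e X) = map (weight c d) X" for X by (simp add: c_def)
    then show ?thesis
      unfolding W_def banded_subseq_iff_chain[OF assms(3-)] mem_Collect_eq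
      by (metis (no_types, lifting) map_is_Nil_conv)
  qed
  have c: "d i j \<le> c" if "i \<in> {i1..i2}" "j \<in> {j1..j2}" for i j
  proof -
    have "{d i j | i j. i \<in> {1..length A} \<and> j \<in> {1..length B}} =
        (\<lambda>(i, j). d i j) ` ({1..length A} \<times> {1..length B})" by force
    then have "finite {d i j | i j. i \<in> {1..length A} \<and> j \<in> {1..length B}}" by simp
    moreover have "d i j \<in> {d i j | i j. i \<in> {1..length A} \<and> j \<in> {1..length B}}"
      using that assms by force
    ultimately show ?thesis unfolding c_def max_dissim_def by (rule Max_ge)
  qed
  have "W \<subseteq> (\<lambda>T. sum_list (map snd T)) ` set (subseqs ?R)"
    unfolding W_def by auto
  then have finW: "finite W" by (rule finite_subset) simp
  have DW: "N - int \<delta> \<in> W" if \<delta>: "\<delta> \<in> D" for \<delta>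
  proof -
    obtain P where P: "alignment i1 i2 j1 j2 P" "\<delta> = discrepancy d P"
      using \<delta> by (auto simp: D_def)
    obtain X where X: "X \<noteq> []" "successively prec X" "\<forall>x\<in>set X. within i1 i2 j1 j2 x"
      "sum_list (map (weight c d) X) + int \<delta> = N"
      using chain_of_alignment[OF P(1), of c d] unfolding N_def P(2) by blast
    have "\<forall>x\<in>set X. within 1 i2 1 j2 x"
      using X(3) assms(3,6) by (auto simp: within_def)
    with X(2) have "sorted_wrt prec X" by (intro sorted_wrt_prec) auto
    moreover have "N - int \<delta> = sum_list (map (weight c d) X)" using X(4) by linarith
    ultimately show ?thesis using X(1,3) unfolding W_iff by blast
  qed
  \<comment> \<open>Stated for chains that may be empty, so that \<open>[]\<close> yields an
    alignment and shows \<open>D\<close> nonempty.\<close>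
  have chain: "\<exists>\<delta>\<in>D. sum_list (map (weight c d) X) + int \<delta> \<le> N"
    if "sorted_wrt prec X" "\<forall>x\<in>set X. within i1 i2 j1 j2 x" for X
    using alignment_of_chain[OF assms(4,7) that, of d c] c unfolding D_def N_def by blast
  then have WD: "\<exists>\<delta>\<in>D. w + int \<delta> \<le> N" if "w \<in> W" for w
    using that unfolding W_iff by blast
  have "D \<noteq> {}" using chain[of "[]"] by auto
  \<comment> \<open>Finiteness of \<open>D\<close> is inherited from \<open>W\<close>, as
    \<open>\<delta>\<close> is recovered from \<open>N - int \<delta>\<close>.\<close>
  have "D \<subseteq> (\<lambda>w. nat (N - w)) ` W"
    using DW by force
  then have finD: "finite D" using finW finite_surj by blast
  \<comment> \<open>A cheapest alignment attains the value, and \<open>WD\<close> bounds every other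
    weight by it.\<close>
  have "Max W = N - int (Min D)"
  proof (rule Max_eqI[OF finW])
    show "N - int (Min D) \<in> W" using DW finD \<open>D \<noteq> {}\<close> by simp
    show "w \<le> N - int (Min D)" if "w \<in> W" for w
      using WD[OF that] Min_le[OF finD] by force
  qed
  moreover have "N = int (max_dissim A B d) *
      (int (length (slice A i1 i2)) + int (length (slice B j1 j2)) - 1)"
    using assms by (simp add: N_def c_def slice_def of_nat_diff)
  ultimately show ?thesis
    by (simp add: dtw_def banded_HIS_weight_def D_def W_def)
qed

end
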